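(* Let $\{w_k=(x_k,y_k,\lambda_k)\}$ be an infinite sequence generated by the PFD-SQO algorithm described in the context. Suppose that there is a constant $\eta>0$ such that $\mathcal H_k^u\succeq \eta I_{n_1+n_2}$ and $\hat{\mathcal H}_k^u\succeq \eta I_{n_1+n_2}$ for all $k\ge0$; that whenever a subsequence $\{w_k\}_{k\in K}$ is bounded, the corresponding subsequences $\{\mathcal H_k^u\}_{k\in K}$ and $\{\hat{\mathcal H}_k^u\}_{k\in K}$ are bounded; and that the set of accumulation points of $\{w_k\}$ is nonempty. Let $w_*=(x_*,y_*,\lambda_* )$ be an accumulation point of $\{w_k\}$ and put $$C_0=\mathcal L_\beta(w_0)-(f(x_* )+\theta(y_* )),\qquad \mathcal N_0=\min\{\rho\eta,\xi\},$$ $$\epsilon_k=\|(x_{k+1}-x_k,\,y_{k+1}-y_k,\,Ax_{k+1}+By_{k+1}-b)\|,\qquad \hat\epsilon_k=\frac{\epsilon_k}{\|(x_k,y_k,b)\|+1}.$$ Then for every non-negative integer $k$ there exists an index $i_k\le k$ such that $$\hat\epsilon_{i_k}\le\epsilon_{i_k}\le\sqrt{\frac{C_0}{\mathcal N_0}}\sqrt{\frac1{k+1}}.$$ Consequently, for any given $\epsilon>0$, whether the algorithm is terminated as soon as $\epsilon_k<\epsilon$ or as soon as $\hat\epsilon_k<\epsilon$, the number of iterations performed is at most $\left[\frac{C_0}{\epsilon^2\mathcal N_0}\right]+1$, where $[a]$ denotes the largest integer not exceeding $a$.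
   Context: **Problem (P).** Minimize $f(x)+\theta(y)$ subject to $Ax+By-b=0$, $Ex+Fy-d\le 0$, $x\in\mathcal X:=\{x\in\mathbb R^{n_1}: l\le Cx\le v\}$, $y\in\mathcal Y:=\{y\in\mathbb R^{n_2}: s\le Dy\le r\}$. Here $f:\mathbb R^{n_1}\to\mathbb R$, $\theta:\mathbb R^{n_2}\to\mathbb R$ are continuously differentiable; $A\in\mathbb R^{m_1\times n_1}$, $B\in\mathbb R^{m_1\times n_2}$, $b\in\mathbb R^{m_1}$, $E\in\mathbb R^{m_2\times n_1}$, $F\in\mathbb R^{m_2\times n_2}$, $d\in\mathbb R^{m_2}$, $C\in\mathbb R^{l_1\times n_1}$, $D\in\mathbb R^{l_2\times n_2}$; $l,s$ have entries in $\mathbb R\cup\{-\infty\}$, $v,r$ have entries in $\mathbb R\cup\{+\infty\}$, $l<v$, $s<r$ componentwise. Write $u=(x,y)$, $w=(x,y,\lambda)$, $\|z\|_H^2=z^\top Hz$, and $\mathcal F_+:=\{(x,y)\in\mathcal X\times\mathcal Y: Ex+Fy-d\le0\}$. The multiplier of an infinite bound is $0$ by convention. **Augmented Lagrangian.** $\mathcal L_\beta(x,y,\lambda)=f(x)+\theta(y)-\lambda^\top(Ax+By-b)+\frac\beta2\|Ax+By-b\|^2$. **PFD-SQO algorithm.** Parameters: $\rho,\sigma\in(0,1)$, $\tau_1,\tau_2>0$, $c\in[0,1]$, $\beta,\xi>0$, $M,M_1>0$, $M_2\ge0$. Start: $u_0=(x_0,y_0)\in\mathcal F_+$, $\lambda_0\in\mathbb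 R^{m_1}$, symmetric positive definite $H_0^x,H_0^y$. At iteration $k$, given $u_k=(x_k,y_k)$, $\lambda_k$ and symmetric $H_k^x,H_k^y$, put $h_k=Ex_k+Fy_k-d$, $\mathcal H_k^x=H_k^x+\beta A^\top A$, $\mathcal H_k^y=H_k^y+\beta B^\top B$, $\mathcal H_k^u=\mathrm{diag}(\mathcal H_k^x,\mathcal H_k^y)$, $\hat{\mathcal H}_k^u=\mathrm{diag}(H_k^x,H_k^y)+\beta(A\ B)^\top(A\ B)$; it is required throughout that $\mathcal H_k^x$, $\mathcal H_k^y$, $\hat{\mathcal H}_k^u$ are positive definite. Step 1. Let $\tilde x_{k+1}$ be the minimizer of $[\nabla f(x_k)-A^\top(\lambda_k-\beta(Ax_k+By_k-b))]^\top(x-x_k)+\frac12\|x-x_k\|^2_{\mathcal H_k^x}$ subject to $Ex+Fy_k-d\le\frac c2h_k$, $l\le Cx\le v$, with KKT multipliers $\mu_k^x,\alpha_k^x,\gamma_k^x\ge 0$ for the constraints $Ex+Fy_k-d\le\frac c2h_k$, $Cx\ge l$, $Cx\le v$, respectively. Let $\tilde y_{k+1}$ be the minimizer of $[\nabla\theta(y_k)-B^\top(\lambda_k-\beta(Ax_k+By_k-b))]^\top(y-y_k)+\frac12\|y-y_k\|^2_{\mathcal H_k^y}$ subject to $Ex_k+Fy-d\le\frac c2h_k$, $s\le Dy\le r$, with KKT multipliers $\mu_k^y,\alpha_k^y,\gamma_k^y\ge0$ for $Ex_k+Fy-d\le\frac c2h_k$, $Dy\ge s$, $Dy\le r$. Step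 2. Put $d_k^x=\tilde x_{k+1}-x_k$, $d_k^y=\tilde y_{k+1}-y_k$, $d_k^u=(d_k^x,d_k^y)$. If $\min\{\|\mu_k^x\|,\|\mu_k^y\|\}\le M$ and $\|\mu_k^x-\mu_k^y\|\le M_1(\|d_k^u\|^{\tau_1}+M_2\|Ax_k+By_k-b\|^{\tau_2})$, set $\tilde{\mathcal H}_k^u=\mathcal H_k^u$, $c_{\max}=\frac1{2-c}$ and go to Step 4; otherwise go to Step 3. Step 3. Let $(\tilde x_{k+1},\tilde y_{k+1})$ be the minimizer of $\nabla f(x_k)^\top(x-x_k)+\frac12\|x-x_k\|^2_{H_k^x}+\nabla\theta(y_k)^\top(y-y_k)+\frac12\|y-y_k\|^2_{H_k^y}-\lambda_k^\top(Ax+By-b)+\frac\beta2\|Ax+By-b\|^2$ subject to $Ex+Fy-d\le0$, $x\in\mathcal X$, $y\in\mathcal Y$. Redefine $d_k^u=(\tilde x_{k+1}-x_k,\tilde y_{k+1}-y_k)$ and set $\tilde{\mathcal H}_k^u=\hat{\mathcal H}_k^u$, $c_{\max}=1$. Step 4. Let $t_k$ be the largest $t\in\{c_{\max}\sigma^i:i=0,1,2,\dots\}$ with $\mathcal L_\beta(u_k+td_k^u,\lambda_k)\le\mathcal L_\beta(w_k)-\rho t\|d_k^u\|^2_{\tilde{\mathcal H}_k^u}$. Step 5. $u_{k+1}=(x_{k+1},y_{k+1})=u_k+t_kd_k^u$, $\lambda_{k+1}=\lambda_k+\xi(Ax_{k+1}+By_{k+1}-b)$, $w_{k+1}=(u_{k+1},\lambda_{k+1})$.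 If $(x_{k+1}-x_k,y_{k+1}-y_k,Ax_{k+1}+By_{k+1}-b)=0$, stop. Otherwise choose new symmetric $H_{k+1}^x,H_{k+1}^y$ satisfying the positive definiteness requirement and continue with $k+1$. *)

theory Defs
  imports "HOL-Analysis.Analysis"
begin

section \<open>Vectors, block matrices and quadratic forms\<close>

definition vjoin :: "'r ^ 'a \<Rightarrow> 'r ^ 'b \<Rightarrow> 'r ^ ('a + 'b)" where
  "vjoin x y = (\<chi> i. case i of Inl a \<Rightarrow> x $ a | Inr b \<Rightarrow> y $ b)"

text \<open>The row block matrix \<open>(A B)\<close>.\<close>
definition hcat :: "real ^ 'a ^ 'm \<Rightarrow> real ^ 'b ^ 'm \<Rightarrow> real ^ ('a + 'b) ^ 'm" where
  "hcat A B = (\<chi> i. vjoin (A $ i) (B $ i))"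

definition block_diag ::
    "real ^ 'a ^ 'a \<Rightarrow> real ^ 'b ^ 'b \<Rightarrow> real ^ ('a + 'b) ^ ('a + 'b)" where
  "block_diag P Q = vjoin (\<chi> a. vjoin (P $ a) 0) (\<chi> b. vjoin 0 (Q $ b))"

definition symmetric :: "real ^ 'n ^ 'n \<Rightarrow> bool" where
  "symmetric H \<longleftrightarrow> transpose H = H"

text \<open>\<open>qform H z\<close> is the paper's \<open>\<parallel>z\<parallel>\<close>-squared with respect to \<open>H\<close>; \<open>H\<close> need not be definite.\<close>
definition qform :: "real ^ 'n ^ 'n \<Rightarrow> real ^ 'n \<Rightarrow> real" where
  "qform H z = z \<bullet> (H *v z)"

definition pos_def :: "real ^ 'n ^ 'n \<Rightarrow> bool" where
  "pos_def H \<longleftrightarrow> symmetric H \<and> (\<forall>z. z \<noteq> 0 \<longrightarrow> 0 < qform H z)"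

definition pos_semidef :: "real ^ 'n ^ 'n \<Rightarrow> bool" where
  "pos_semidef H \<longleftrightarrow> symmetric H \<and> (\<forall>z. 0 \<le> qform H z)"

definition loewner_ge :: "real ^ 'n ^ 'n \<Rightarrow> real ^ 'n ^ 'n \<Rightarrow> bool" (infix "\<succeq>\<^sub>L" 50) where
  "H \<succeq>\<^sub>L G \<longleftrightarrow> pos_semidef (H - G)"

text \<open>The gradient is unspecified where the function is not differentiable.\<close>
definition grad :: "('a::real_inner \<Rightarrow> real) \<Rightarrow> 'a \<Rightarrow> 'a" where
  "grad f x = (THE g. GDERIV f x :> g)"

definition continuously_differentiable :: "('a::euclidean_space \<Rightarrow> real) \<Rightarrow> bool" where
  "continuously_differentiable f \<longleftrightarrow>
     (\<forall>x. f differentiable (at x)) \<and> continuous_on UNIV (grad f)"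

definition accumulation_points :: "(nat \<Rightarrow> 'a::topological_space) \<Rightarrow> 'a set" where
  "accumulation_points w = {a. \<exists>r. strict_mono r \<and> (w \<circ> r) \<longlonglongrightarrow> a}"

section \<open>Problem data\<close>

text \<open>
  Minimize \<open>obj_x x + obj_y y\<close> subject to \<open>A x + B y = b\<close>, \<open>E x + F y \<le> d\<close>,
  \<open>l \<le> C x \<le> v\<close>, \<open>s \<le> D y \<le> r\<close>.
\<close>
record ('n1, 'n2, 'm1, 'm2, 'l1, 'l2) two_block_problem =
  obj_x :: "real ^ 'n1 \<Rightarrow> real"
  obj_y :: "real ^ 'n2 \<Rightarrow> real"
  mat_A :: "real ^ 'n1 ^ 'm1"
  mat_B :: "real ^ 'n2 ^ 'm1"
  vec_b :: "real ^ 'm1"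
  mat_E :: "real ^ 'n1 ^ 'm2"
  mat_F :: "real ^ 'n2 ^ 'm2"
  vec_d :: "real ^ 'm2"
  mat_C :: "real ^ 'n1 ^ 'l1"
  mat_D :: "real ^ 'n2 ^ 'l2"
  vec_l :: "ereal ^ 'l1"
  vec_v :: "ereal ^ 'l1"
  vec_s :: "ereal ^ 'l2"
  vec_r :: "ereal ^ 'l2"

definition valid_bounds :: "ereal ^ 'l \<Rightarrow> ereal ^ 'l \<Rightarrow> bool" where
  "valid_bounds lo up \<longleftrightarrow> (\<forall>i. lo $ i \<noteq> \<infinity> \<and> up $ i \<noteq> -\<infinity> \<and> lo $ i < up $ i)"

definition valid_problem ::
    "('n1::finite, 'n2::finite, 'm1::finite, 'm2::finite, 'l1::finite, 'l2::finite)
       two_block_problem \<Rightarrow> bool" where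
  "valid_problem P \<longleftrightarrow>
     continuously_differentiable (obj_x P) \<and> continuously_differentiable (obj_y P) \<and>
     valid_bounds (vec_l P) (vec_v P) \<and> valid_bounds (vec_s P) (vec_r P)"

definition polyhedron_box :: "ereal ^ 'l \<Rightarrow> real ^ 'n ^ 'l \<Rightarrow> ereal ^ 'l \<Rightarrow> (real ^ 'n) set" where
  "polyhedron_box lo C up =
     {z. \<forall>i. lo $ i \<le> ereal ((C *v z) $ i) \<and> ereal ((C *v z) $ i) \<le> up $ i}"

definition eq_resid ::
    "('n1::finite, 'n2::finite, 'm1::finite, 'm2::finite, 'l1::finite, 'l2::finite)
       two_block_problem \<Rightarrow> real ^ 'n1 \<Rightarrow> real ^ 'n2 \<Rightarrow> real ^ 'm1" where
  "eq_resid P x y = mat_A P *v x + mat_B P *v y - vec_b P"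

definition ineq_resid ::
    "('n1::finite, 'n2::finite, 'm1::finite, 'm2::finite, 'l1::finite, 'l2::finite)
       two_block_problem \<Rightarrow> real ^ 'n1 \<Rightarrow> real ^ 'n2 \<Rightarrow> real ^ 'm2" where
  "ineq_resid P x y = mat_E P *v x + mat_F P *v y - vec_d P"

definition F_plus ::
    "('n1::finite, 'n2::finite, 'm1::finite, 'm2::finite, 'l1::finite, 'l2::finite)
       two_block_problem \<Rightarrow> ((real ^ 'n1) \<times> (real ^ 'n2)) set" where
  "F_plus P = {(x, y). x \<in> polyhedron_box (vec_l P) (mat_C P) (vec_v P) \<and>
                       y \<in> polyhedron_box (vec_s P) (mat_D P) (vec_r P) \<and>
                       ineq_resid P x y \<le> 0}"

definition aug_lagrangian ::
    "('n1::finite, 'n2::finite, 'm1::finite, 'm2::finite, 'l1::finite, 'l2::finite)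
       two_block_problem \<Rightarrow> real \<Rightarrow> real ^ 'n1 \<Rightarrow> real ^ 'n2 \<Rightarrow> real ^ 'm1 \<Rightarrow> real" where
  "aug_lagrangian P \<beta> x y lam =
     obj_x P x + obj_y P y - lam \<bullet> eq_resid P x y + \<beta> / 2 * (norm (eq_resid P x y))\<^sup>2"

section \<open>The algorithm\<close>

record sqo_params =
  par_rho :: real
  par_sigma :: real
  par_tau1 :: real
  par_tau2 :: real
  par_c :: real
  par_beta :: real
  par_xi :: real
  par_M :: real
  par_M1 :: real
  par_M2 :: real

definition valid_params :: "sqo_params \<Rightarrow> bool" where
  "valid_params Q \<longleftrightarrow>
     0 < par_rho Q \<and> par_rho Q < 1 \<and> 0 < par_sigma Q \<and> par_sigma Q < 1 \<and>
     0 < par_tau1 Q \<and> 0 < par_tau2 Q \<and> 0 \<le> par_c Q \<and> par_c Q \<le> 1 \<and>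
     0 < par_beta Q \<and> 0 < par_xi Q \<and> 0 < par_M Q \<and> 0 < par_M1 Q \<and> 0 \<le> par_M2 Q"

definition calH_x ::
    "('n1::finite, 'n2::finite, 'm1::finite, 'm2::finite, 'l1::finite, 'l2::finite)
       two_block_problem \<Rightarrow> real \<Rightarrow> real ^ 'n1 ^ 'n1 \<Rightarrow> real ^ 'n1 ^ 'n1" where
  "calH_x P \<beta> Hx = Hx + \<beta> *\<^sub>R (transpose (mat_A P) ** mat_A P)"

definition calH_y ::
    "('n1::finite, 'n2::finite, 'm1::finite, 'm2::finite, 'l1::finite, 'l2::finite)
       two_block_problem \<Rightarrow> real \<Rightarrow> real ^ 'n2 ^ 'n2 \<Rightarrow> real ^ 'n2 ^ 'n2" where
  "calH_y P \<beta> Hy = Hy + \<beta> *\<^sub>R (transpose (mat_B P) ** mat_B P)"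

definition calH_u ::
    "('n1::finite, 'n2::finite, 'm1::finite, 'm2::finite, 'l1::finite, 'l2::finite)
       two_block_problem \<Rightarrow> real \<Rightarrow> real ^ 'n1 ^ 'n1 \<Rightarrow> real ^ 'n2 ^ 'n2 \<Rightarrow>
       real ^ ('n1 + 'n2) ^ ('n1 + 'n2)" where
  "calH_u P \<beta> Hx Hy = block_diag (calH_x P \<beta> Hx) (calH_y P \<beta> Hy)"

definition hatH_u ::
    "('n1::finite, 'n2::finite, 'm1::finite, 'm2::finite, 'l1::finite, 'l2::finite)
       two_block_problem \<Rightarrow> real \<Rightarrow> real ^ 'n1 ^ 'n1 \<Rightarrow> real ^ 'n2 ^ 'n2 \<Rightarrow>
       real ^ ('n1 + 'n2) ^ ('n1 + 'n2)" where
  "hatH_u P \<beta> Hx Hy = block_diag Hx Hy +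
     \<beta> *\<^sub>R (transpose (hcat (mat_A P) (mat_B P)) ** hcat (mat_A P) (mat_B P))"

definition admissible_hessians ::
    "('n1::finite, 'n2::finite, 'm1::finite, 'm2::finite, 'l1::finite, 'l2::finite)
       two_block_problem \<Rightarrow> real \<Rightarrow> real ^ 'n1 ^ 'n1 \<Rightarrow> real ^ 'n2 ^ 'n2 \<Rightarrow> bool" where
  "admissible_hessians P \<beta> Hx Hy \<longleftrightarrow> symmetric Hx \<and> symmetric Hy \<and>
     pos_def (calH_x P \<beta> Hx) \<and> pos_def (calH_y P \<beta> Hy) \<and> pos_def (hatH_u P \<beta> Hx Hy)"

text \<open>
  \<open>z'\<close> minimizes the quadratic model with linear term \<open>g\<close> and Hessian \<open>H\<close> around \<open>z\<close>, subject to
  \<open>G z' + q \<le> h\<close> and \<open>lo \<le> C z' \<le> up\<close>, and \<open>\<mu>\<close>, \<open>\<alpha>\<close>, \<open>\<gamma>\<close> are KKT multipliers of the general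
  constraint, the lower and the upper bounds. The multiplier of an infinite bound is 0; only the
  finite bounds carry a complementarity condition, so \<open>real_of_ereal\<close> is used there without loss.
\<close>
definition solves_block_qp ::
    "real ^ 'n \<Rightarrow> real ^ 'n ^ 'n \<Rightarrow> real ^ 'n \<Rightarrow> real ^ 'n ^ 'm \<Rightarrow> real ^ 'm \<Rightarrow> real ^ 'm \<Rightarrow>
     ereal ^ 'l \<Rightarrow> real ^ 'n ^ 'l \<Rightarrow> ereal ^ 'l \<Rightarrow>
     real ^ 'n \<Rightarrow> real ^ 'm \<Rightarrow> real ^ 'l \<Rightarrow> real ^ 'l \<Rightarrow> bool" where
  "solves_block_qp g H z G q h lo C up z' \<mu> \<alpha> \<gamma> \<longleftrightarrow>
     is_arg_min (\<lambda>p. g \<bullet> (p - z) + 1 / 2 * qform H (p - z))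
       (\<lambda>p. G *v p + q \<le> h \<and> p \<in> polyhedron_box lo C up) z' \<and>
     0 \<le> \<mu> \<and> 0 \<le> \<alpha> \<and> 0 \<le> \<gamma> \<and>
     g + H *v (z' - z) + transpose G *v \<mu> - transpose C *v \<alpha> + transpose C *v \<gamma> = 0 \<and>
     (\<forall>i. \<mu> $ i * (G *v z' + q - h) $ i = 0) \<and>
     (\<forall>i. if lo $ i = -\<infinity> then \<alpha> $ i = 0
           else \<alpha> $ i * ((C *v z') $ i - real_of_ereal (lo $ i)) = 0) \<and>
     (\<forall>i. if up $ i = \<infinity> then \<gamma> $ i = 0
           else \<gamma> $ i * ((C *v z') $ i - real_of_ereal (up $ i)) = 0)"

definition solves_x_subproblem ::
    "('n1::finite, 'n2::finite, 'm1::finite, 'm2::finite, 'l1::finite, 'l2::finite)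
       two_block_problem \<Rightarrow> sqo_params \<Rightarrow> real ^ 'n1 ^ 'n1 \<Rightarrow>
     real ^ 'n1 \<Rightarrow> real ^ 'n2 \<Rightarrow> real ^ 'm1 \<Rightarrow>
     real ^ 'n1 \<Rightarrow> real ^ 'm2 \<Rightarrow> real ^ 'l1 \<Rightarrow> real ^ 'l1 \<Rightarrow> bool" where
  "solves_x_subproblem P Q Hx x y lam x' \<mu> \<alpha> \<gamma> \<longleftrightarrow>
     solves_block_qp
       (grad (obj_x P) x - transpose (mat_A P) *v (lam - par_beta Q *\<^sub>R eq_resid P x y))
       (calH_x P (par_beta Q) Hx) x
       (mat_E P) (mat_F P *v y - vec_d P) ((par_c Q / 2) *\<^sub>R ineq_resid P x y)
       (vec_l P) (mat_C P) (vec_v P) x' \<mu> \<alpha> \<gamma>"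

definition solves_y_subproblem ::
    "('n1::finite, 'n2::finite, 'm1::finite, 'm2::finite, 'l1::finite, 'l2::finite)
       two_block_problem \<Rightarrow> sqo_params \<Rightarrow> real ^ 'n2 ^ 'n2 \<Rightarrow>
     real ^ 'n1 \<Rightarrow> real ^ 'n2 \<Rightarrow> real ^ 'm1 \<Rightarrow>
     real ^ 'n2 \<Rightarrow> real ^ 'm2 \<Rightarrow> real ^ 'l2 \<Rightarrow> real ^ 'l2 \<Rightarrow> bool" where
  "solves_y_subproblem P Q Hy x y lam y' \<mu> \<alpha> \<gamma> \<longleftrightarrow>
     solves_block_qp
       (grad (obj_y P) y - transpose (mat_B P) *v (lam - par_beta Q *\<^sub>R eq_resid P x y))
       (calH_y P (par_beta Q) Hy) y
       (mat_F P) (mat_E P *v x - vec_d P) ((par_c Q / 2) *\<^sub>R ineq_resid P x y)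
       (vec_s P) (mat_D P) (vec_r P) y' \<mu> \<alpha> \<gamma>"

text \<open>
  Norms of stacked vectors are taken in product types, whose norm is the Euclidean one.
\<close>
definition accepts_block_step ::
    "('n1::finite, 'n2::finite, 'm1::finite, 'm2::finite, 'l1::finite, 'l2::finite)
       two_block_problem \<Rightarrow> sqo_params \<Rightarrow> real ^ 'n1 \<Rightarrow> real ^ 'n2 \<Rightarrow>
     real ^ 'n1 \<Rightarrow> real ^ 'n2 \<Rightarrow> real ^ 'm2 \<Rightarrow> real ^ 'm2 \<Rightarrow> bool" where
  "accepts_block_step P Q x y dx dy \<mu>x \<mu>y \<longleftrightarrow>
     min (norm \<mu>x) (norm \<mu>y) \<le> par_M Q \<and>
     norm (\<mu>x - \<mu>y) \<le> par_M1 Q * (norm (dx, dy) powr par_tau1 Q +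
                                    par_M2 Q * norm (eq_resid P x y) powr par_tau2 Q)"

definition solves_joint_subproblem ::
    "('n1::finite, 'n2::finite, 'm1::finite, 'm2::finite, 'l1::finite, 'l2::finite)
       two_block_problem \<Rightarrow> sqo_params \<Rightarrow> real ^ 'n1 ^ 'n1 \<Rightarrow> real ^ 'n2 ^ 'n2 \<Rightarrow>
     real ^ 'n1 \<Rightarrow> real ^ 'n2 \<Rightarrow> real ^ 'm1 \<Rightarrow> real ^ 'n1 \<Rightarrow> real ^ 'n2 \<Rightarrow> bool" where
  "solves_joint_subproblem P Q Hx Hy x y lam x' y' \<longleftrightarrow>
     is_arg_min
       (\<lambda>(p, q). grad (obj_x P) x \<bullet> (p - x) + 1 / 2 * qform Hx (p - x) +
                 grad (obj_y P) y \<bullet> (q - y) + 1 / 2 * qform Hy (q - y) -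
                 lam \<bullet> eq_resid P p q + par_beta Q / 2 * (norm (eq_resid P p q))\<^sup>2)
       (\<lambda>z. z \<in> F_plus P) (x', y')"

definition is_line_search_step ::
    "('n1::finite, 'n2::finite, 'm1::finite, 'm2::finite, 'l1::finite, 'l2::finite)
       two_block_problem \<Rightarrow> sqo_params \<Rightarrow> real \<Rightarrow> real ^ ('n1 + 'n2) ^ ('n1 + 'n2) \<Rightarrow>
     real ^ 'n1 \<Rightarrow> real ^ 'n2 \<Rightarrow> real ^ 'm1 \<Rightarrow> real ^ 'n1 \<Rightarrow> real ^ 'n2 \<Rightarrow> real \<Rightarrow> bool" where
  "is_line_search_step P Q cmax H x y lam dx dy t \<longleftrightarrow>
     is_arg_max (\<lambda>t. t)
       (\<lambda>t. t \<in> range (\<lambda>i::nat. cmax * par_sigma Q ^ i) \<and>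
            aug_lagrangian P (par_beta Q) (x + t *\<^sub>R dx) (y + t *\<^sub>R dy) lam
              \<le> aug_lagrangian P (par_beta Q) x y lam - par_rho Q * t * qform H (vjoin dx dy)) t"

text \<open>
  One iteration, as a relation: the KKT multipliers of the block subproblems need not be unique.
\<close>
definition pfd_sqo_iteration ::
    "('n1::finite, 'n2::finite, 'm1::finite, 'm2::finite, 'l1::finite, 'l2::finite)
       two_block_problem \<Rightarrow> sqo_params \<Rightarrow> real ^ 'n1 ^ 'n1 \<Rightarrow> real ^ 'n2 ^ 'n2 \<Rightarrow>
     real ^ 'n1 \<Rightarrow> real ^ 'n2 \<Rightarrow> real ^ 'm1 \<Rightarrow> real ^ 'n1 \<Rightarrow> real ^ 'n2 \<Rightarrow> real ^ 'm1 \<Rightarrow> bool" where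
  "pfd_sqo_iteration P Q Hx Hy x y lam x' y' lam' \<longleftrightarrow>
     (\<exists>xt yt \<mu>x \<alpha>x \<gamma>x \<mu>y \<alpha>y \<gamma>y dx dy H cmax t.
        solves_x_subproblem P Q Hx x y lam xt \<mu>x \<alpha>x \<gamma>x \<and>
        solves_y_subproblem P Q Hy x y lam yt \<mu>y \<alpha>y \<gamma>y \<and>
        (if accepts_block_step P Q x y (xt - x) (yt - y) \<mu>x \<mu>y
         then dx = xt - x \<and> dy = yt - y \<and>
              H = calH_u P (par_beta Q) Hx Hy \<and> cmax = 1 / (2 - par_c Q)
         else solves_joint_subproblem P Q Hx Hy x y lam (x + dx) (y + dy) \<and>
              H = hatH_u P (par_beta Q) Hx Hy \<and> cmax = 1) \<and>
        is_line_search_step P Q cmax H x y lam dx dy t \<and>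
        x' = x + t *\<^sub>R dx \<and> y' = y + t *\<^sub>R dy \<and>
        lam' = lam + par_xi Q *\<^sub>R eq_resid P x' y')"

text \<open>An infinite run: the stopping test never succeeds.\<close>
definition pfd_sqo_infinite_run ::
    "('n1::finite, 'n2::finite, 'm1::finite, 'm2::finite, 'l1::finite, 'l2::finite)
       two_block_problem \<Rightarrow> sqo_params \<Rightarrow>
     (nat \<Rightarrow> real ^ 'n1 ^ 'n1) \<Rightarrow> (nat \<Rightarrow> real ^ 'n2 ^ 'n2) \<Rightarrow>
     (nat \<Rightarrow> real ^ 'n1) \<Rightarrow> (nat \<Rightarrow> real ^ 'n2) \<Rightarrow> (nat \<Rightarrow> real ^ 'm1) \<Rightarrow> bool" where
  "pfd_sqo_infinite_run P Q Hx Hy x y lam \<longleftrightarrow>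
     (x 0, y 0) \<in> F_plus P \<and> pos_def (Hx 0) \<and> pos_def (Hy 0) \<and>
     (\<forall>k. admissible_hessians P (par_beta Q) (Hx k) (Hy k) \<and>
          pfd_sqo_iteration P Q (Hx k) (Hy k) (x k) (y k) (lam k)
            (x (Suc k)) (y (Suc k)) (lam (Suc k)) \<and>
          (x (Suc k) - x k, y (Suc k) - y k, eq_resid P (x (Suc k)) (y (Suc k))) \<noteq> 0)"

text \<open>
  \<open>stop k\<close> is tested in iteration \<open>k\<close>, the one that produces the iterate \<open>k + 1\<close>, and iterations
  are numbered from 0. Meaningful only if \<open>stop k\<close> holds for some \<open>k\<close>.
\<close>
definition iterations_performed :: "(nat \<Rightarrow> bool) \<Rightarrow> nat" where
  "iterations_performed stop = Suc (LEAST k. stop k)"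

end

theory Submission
  imports Defs
begin

text \<open>
  Along a run the augmented Lagrangian is a Lyapunov function: the line search, together with
  \<open>t \<le> 1\<close>, lowers it by at least \<open>\<rho> \<eta>\<close> times the squared primal step, and the multiplier update
  by exactly \<open>\<xi>\<close> times the squared equality residual. Hence its values decrease to the value at
  the accumulation point, and the \<open>\<epsilon>\<^sub>k\<close> are square summable. So the residual vanishes in the limit, the
  augmented Lagrangian reduces there to the objective, and the sum of the squares is at most
  \<open>C\<^sub>0 / N\<^sub>0\<close>.
\<close>

section \<open>Quadratic forms and stacked vectors\<close>

lemma loewner_ge_mat_imp_qform_ge:
  fixes H :: "real ^ 'n ^ 'n"
  assumes "H \<succeq>\<^sub>L mat \<eta>"
  shows "\<eta> * (norm z)\<^sup>2 \<le> qform H z"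
proof -
  have "(mat \<eta> :: real ^ 'n ^ 'n) *v z = \<eta> *\<^sub>R z"
    by (simp add: vec_eq_iff matrix_vector_mult_def mat_def if_distrib [of "\<lambda>u. u * _"] cong: if_cong)
  moreover have "0 \<le> z \<bullet> ((H - mat \<eta>) *v z)"
    using assms by (simp add: loewner_ge_def pos_semidef_def qform_def)
  ultimately show ?thesis
    by (simp add: qform_def matrix_vector_mult_diff_rdistrib inner_diff_right power2_norm_eq_inner)
qed

lemma norm_vjoin_sq:
  fixes x :: "real ^ 'a" and y :: "real ^ 'b"
  shows "(norm (vjoin x y))\<^sup>2 = (norm x)\<^sup>2 + (norm y)\<^sup>2"
proof -
  have "(\<Sum>i\<in>UNIV. vjoin x y $ i * vjoin x y $ i)
      = (\<Sum>a\<in>UNIV. x $ a * x $ a) + (\<Sum>b\<in>UNIV. y $ b * y $ b)"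
    by (simp add: vjoin_def sum.Plus flip: UNIV_Plus_UNIV)
  then show ?thesis
    by (simp add: power2_norm_eq_inner inner_vec_def)
qed

section \<open>Decrease of the augmented Lagrangian in one iteration\<close>

lemma aug_lagrangian_multiplier_update:
  "aug_lagrangian P \<beta> x y (lam + \<xi> *\<^sub>R eq_resid P x y)
     = aug_lagrangian P \<beta> x y lam - \<xi> * (norm (eq_resid P x y))\<^sup>2"
  by (simp add: aug_lagrangian_def inner_add_left power2_norm_eq_inner)

lemma is_line_search_step_descent:
  fixes dx :: "real ^ 'n1::finite" and dy :: "real ^ 'n2::finite"
  assumes Q: "valid_params Q" and cmax: "0 < cmax" "cmax \<le> 1" and "0 < \<eta>"
    and H: "H \<succeq>\<^sub>L mat \<eta>"
    and step: "is_line_search_step P Q cmax H x y lam dx dy t"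
  shows "par_rho Q * \<eta> * (norm (t *\<^sub>R dx, t *\<^sub>R dy))\<^sup>2
     \<le> aug_lagrangian P (par_beta Q) x y lam
        - aug_lagrangian P (par_beta Q) (x + t *\<^sub>R dx) (y + t *\<^sub>R dy) lam"
proof -
  have rho: "0 < par_rho Q" and sigma: "0 < par_sigma Q" "par_sigma Q < 1"
    using Q by (auto simp: valid_params_def)
  obtain i where t: "t = cmax * par_sigma Q ^ i"
    and desc: "aug_lagrangian P (par_beta Q) (x + t *\<^sub>R dx) (y + t *\<^sub>R dy) lam
       \<le> aug_lagrangian P (par_beta Q) x y lam - par_rho Q * t * qform H (vjoin dx dy)"
    using step by (auto simp: is_line_search_step_def is_arg_max_def)
  have "0 < t" using t cmax sigma by simp
  have "t \<le> 1"
    unfolding t using cmax sigma by (intro mult_le_one) (auto simp: power_le_one)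
  define n where "n = (norm dx)\<^sup>2 + (norm dy)\<^sup>2"
  have "(norm (t *\<^sub>R dx, t *\<^sub>R dy))\<^sup>2 = t * (t * n)"
    by (simp add: norm_Pair n_def power_mult_distrib power2_eq_square algebra_simps)
  also have "\<dots> \<le> 1 * (t * n)"
    using \<open>0 < t\<close> \<open>t \<le> 1\<close> by (intro mult_right_mono) (auto simp: n_def)
  finally have "par_rho Q * \<eta> * (norm (t *\<^sub>R dx, t *\<^sub>R dy))\<^sup>2 \<le> par_rho Q * \<eta> * (t * n)"
    using rho \<open>0 < \<eta>\<close> by (intro mult_left_mono) auto
  also have "\<dots> = par_rho Q * t * (\<eta> * n)" by simp
  also have "\<dots> \<le> par_rho Q * t * qform H (vjoin dx dy)"
    using rho \<open>0 < t\<close> loewner_ge_mat_imp_qform_ge [OF H, of "vjoin dx dy"]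
    by (intro mult_left_mono) (auto simp: norm_vjoin_sq n_def)
  finally show ?thesis using desc by linarith
qed

text \<open>Both branches give the same estimate: either matrix dominates \<open>mat \<eta>\<close>
  and either \<open>cmax\<close> lies in (0, 1]. The minimum is a common constant for the primal
  decrease and the multiplier decrease.\<close>

lemma pfd_sqo_iteration_descent:
  assumes Q: "valid_params Q" and "0 < \<eta>"
    and calH: "calH_u P (par_beta Q) Hx Hy \<succeq>\<^sub>L mat \<eta>"
    and hatH: "hatH_u P (par_beta Q) Hx Hy \<succeq>\<^sub>L mat \<eta>"
    and iter: "pfd_sqo_iteration P Q Hx Hy x y lam x' y' lam'"
  shows "min (par_rho Q * \<eta>) (par_xi Q) * (norm (x' - x, y' - y, eq_resid P x' y'))\<^sup>2
     \<le> aug_lagrangian P (par_beta Q) x y lam - aug_lagrangian P (par_beta Q) x' y' lam'"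
proof -
  have c: "0 \<le> par_c Q" "par_c Q \<le> 1"
    using Q by (auto simp: valid_params_def)
  obtain xt yt \<mu>x \<mu>y dx dy H cmax t where branch:
      "if accepts_block_step P Q x y (xt - x) (yt - y) \<mu>x \<mu>y
       then dx = xt - x \<and> dy = yt - y \<and>
            H = calH_u P (par_beta Q) Hx Hy \<and> cmax = 1 / (2 - par_c Q)
       else solves_joint_subproblem P Q Hx Hy x y lam (x + dx) (y + dy) \<and>
            H = hatH_u P (par_beta Q) Hx Hy \<and> cmax = 1"
    and step: "is_line_search_step P Q cmax H x y lam dx dy t"
    and x': "x' = x + t *\<^sub>R dx" and y': "y' = y + t *\<^sub>R dy"
    and lam': "lam' = lam + par_xi Q *\<^sub>R eq_resid P x' y'"
    using iter unfolding pfd_sqo_iteration_def by blast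
  have H: "H \<succeq>\<^sub>L mat \<eta>"
    using branch calH hatH by (metis (full_types))
  have "cmax = 1 / (2 - par_c Q) \<or> cmax = 1"
    using branch by (metis (full_types))
  \<comment> \<open>As \<open>par_c Q\<close> lies in [0, 1], the value
    \<open>1 / (2 - par_c Q)\<close> lies in [1/2, 1].\<close>
  then have cmax: "0 < cmax" "cmax \<le> 1"
    using c by auto
  let ?m = "min (par_rho Q * \<eta>) (par_xi Q)"
  have "(norm (x' - x, y' - y, eq_resid P x' y'))\<^sup>2
      = (norm (x' - x, y' - y))\<^sup>2 + (norm (eq_resid P x' y'))\<^sup>2"
    by (simp add: norm_Pair)
  then have "?m * (norm (x' - x, y' - y, eq_resid P x' y'))\<^sup>2
      = ?m * (norm (x' - x, y' - y))\<^sup>2 + ?m * (norm (eq_resid P x' y'))\<^sup>2"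
    by (simp add: distrib_left)
  also have "\<dots> \<le> par_rho Q * \<eta> * (norm (x' - x, y' - y))\<^sup>2
                    + par_xi Q * (norm (eq_resid P x' y'))\<^sup>2"
    by (intro add_mono mult_right_mono) auto
  also have "\<dots> \<le> aug_lagrangian P (par_beta Q) x y lam
                    - aug_lagrangian P (par_beta Q) x' y' lam'"
    \<comment> \<open>The line search accounts for the primal move at fixed \<open>lam\<close>. The
      augmented Lagrangian is affine in the multiplier with slope minus the residual, so the update
      accounts for the second summand.\<close>
    using is_line_search_step_descent [OF Q cmax \<open>0 < \<eta>\<close> H step]
    unfolding lam' aug_lagrangian_multiplier_update by (simp add: x' y')
  finally show ?thesis .
qed

section \<open>Continuity of the residual and of the augmented Lagrangian\<close>

lemma tendsto_eq_resid:
  assumes "(x \<longlongrightarrow> a) G" "(y \<longlongrightarrow> b) G"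
  shows "((\<lambda>k. eq_resid P (x k) (y k)) \<longlongrightarrow> eq_resid P a b) G"
  unfolding eq_resid_def
  by (intro tendsto_intros bounded_linear.tendsto [OF matrix_vector_mul_bounded_linear] assms)

lemma tendsto_aug_lagrangian:
  assumes P: "valid_problem P"
    and x: "(x \<longlongrightarrow> a) G" and y: "(y \<longlongrightarrow> b) G" and lam: "(lam \<longlongrightarrow> c) G"
  shows "((\<lambda>k. aug_lagrangian P \<beta> (x k) (y k) (lam k)) \<longlongrightarrow> aug_lagrangian P \<beta> a b c) G"
proof -
  have "isCont (obj_x P) a" "isCont (obj_y P) b"
    using P by (auto simp: valid_problem_def continuously_differentiable_def
        intro: differentiable_imp_continuous_within)
  then show ?thesis
    unfolding aug_lagrangian_def
    by (intro tendsto_intros isCont_tendsto_compose [OF _ x] isCont_tendsto_compose [OF _ y]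
        tendsto_eq_resid [OF x y] lam)
qed

section \<open>Monotone and square-summable real sequences\<close>

lemma decseq_subseq_LIMSEQ_le:
  fixes L :: "nat \<Rightarrow> real"
  assumes "decseq L" "strict_mono r" "(L \<circ> r) \<longlonglongrightarrow> l"
  shows "l \<le> L n"
proof (rule LIMSEQ_le_const2 [OF assms(3)])
  \<comment> \<open>Since \<open>m \<le> r m\<close>, the choice \<open>N = n\<close> works.\<close>
  show "\<exists>N. \<forall>m\<ge>N. (L \<circ> r) m \<le> L n"
    using decseqD [OF assms(1)] seq_suble [OF assms(2)] by (metis comp_apply order_trans)
qed

text \<open>Averaging: if each of the first \<open>k + 1\<close> squares exceeded
  \<open>S / (k + 1)\<close>, their sum would exceed \<open>S\<close>.\<close>

lemma exists_le_sqrt_of_sum_sq_le: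
  fixes e :: "nat \<Rightarrow> real"
  assumes "\<And>k. 0 \<le> e k" and S: "\<And>n. (\<Sum>i<n. (e i)\<^sup>2) \<le> S"
  shows "\<exists>i\<le>k. e i \<le> sqrt S * sqrt (1 / (real k + 1))"
proof (rule ccontr)
  assume contra: "\<not> ?thesis"
  have "sqrt (S / (real k + 1)) < e i" if "i < Suc k" for i
  proof -
    have "sqrt S * sqrt (1 / (real k + 1)) < e i"
      using contra that by (meson less_Suc_eq_le not_le)
    then show ?thesis by (simp add: real_sqrt_divide)
  qed
  moreover have "0 \<le> S" using S [of 0] by simp
  \<comment> \<open>Nonnegativity lets \<open>e i\<close> be written as the square root of its own
    square, so the roots cancel.\<close>
  ultimately have "S / (real k + 1) < (e i)\<^sup>2" if "i < Suc k" for i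
    using that by (metis real_less_rsqrt real_sqrt_abs real_sqrt_less_iff assms(1) abs_of_nonneg)
  then have "(\<Sum>i<Suc k. S / (real k + 1)) < (\<Sum>i<Suc k. (e i)\<^sup>2)"
    by (intro sum_strict_mono) auto
  also have "(\<Sum>i<Suc k. S / (real k + 1)) = S"
    by (simp only: sum_constant card_lessThan) (simp add: field_simps)
  finally show False using S [of "Suc k"] by linarith
qed

lemma sum_sq_le_imp_tendsto_0:
  fixes e :: "nat \<Rightarrow> real"
  assumes "\<And>n. (\<Sum>i<n. (e i)\<^sup>2) \<le> S"
  shows "e \<longlonglongrightarrow> 0"
proof -
  have "summable (\<lambda>i. (e i)\<^sup>2)"
    using assms by (intro summableI_nonneg_bounded) auto
  then show ?thesis
    using summable_LIMSEQ_zero by fastforce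
qed

text \<open>Each index before the first stop contributes at least the square of
  \<open>\<epsilon>\<close> to a sum bounded by \<open>S\<close>, which limits the number of such
  indices. Only an implication from \<open>e k < \<epsilon>\<close> to \<open>stop k\<close> is
  assumed, so that tests easier to pass than \<open>e k < \<epsilon>\<close> are covered
  too.\<close>

lemma iterations_performed_le:
  fixes e :: "nat \<Rightarrow> real"
  assumes "0 < \<epsilon>" and S: "\<And>n. (\<Sum>i<n. (e i)\<^sup>2) \<le> S"
    and below: "\<And>k. e k < \<epsilon> \<Longrightarrow> stop k"
  shows "\<exists>k. stop k" and "int (iterations_performed stop) \<le> \<lfloor>S / \<epsilon>\<^sup>2\<rfloor> + 1"
proof -
  have "\<forall>\<^sub>F k in sequentially. e k < \<epsilon>"
    using sum_sq_le_imp_tendsto_0 [OF S] \<open>0 < \<epsilon>\<close> by (rule order_tendstoD)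
  then show "\<exists>k. stop k"
    using below by (meson eventually_sequentially order_refl)
  define n where "n = (LEAST k. stop k)"
  have "\<epsilon> \<le> e i" if "i < n" for i
    using not_less_Least that below unfolding n_def by (meson not_less)
  then have "(\<Sum>i<n. \<epsilon>\<^sup>2) \<le> (\<Sum>i<n. (e i)\<^sup>2)"
    using \<open>0 < \<epsilon>\<close> by (intro sum_mono power_mono) auto
  then have "real n * \<epsilon>\<^sup>2 \<le> S"
    using S [of n] by simp
  then have "real n \<le> S / \<epsilon>\<^sup>2"
    using \<open>0 < \<epsilon>\<close> by (simp add: field_simps)
  \<comment> \<open>The stopping iteration itself is counted as well: \<open>n\<close> iterations
    precede it, whence the added 1.\<close>
  then show "int (iterations_performed stop) \<le> \<lfloor>S / \<epsilon>\<^sup>2\<rfloor> + 1"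
    by (simp add: iterations_performed_def n_def [symmetric] le_floor_iff)
qed

section \<open>Summation along the run and the complexity bound\<close>

theorem theorem3p2:
  fixes P :: "('n1::finite, 'n2::finite, 'm1::finite, 'm2::finite, 'l1::finite, 'l2::finite)
                two_block_problem"
    and Q :: sqo_params
    and Hx :: "nat \<Rightarrow> real ^ 'n1 ^ 'n1"
    and Hy :: "nat \<Rightarrow> real ^ 'n2 ^ 'n2"
    and x :: "nat \<Rightarrow> real ^ 'n1"
    and y :: "nat \<Rightarrow> real ^ 'n2"
    and lam :: "nat \<Rightarrow> real ^ 'm1"
    and w :: "nat \<Rightarrow> (real ^ 'n1) \<times> (real ^ 'n2) \<times> (real ^ 'm1)"
    and xs :: "real ^ 'n1" and ys :: "real ^ 'n2" and lams :: "real ^ 'm1"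
    and \<eta> C0 N0 :: real
    and eps epshat :: "nat \<Rightarrow> real"
  assumes problem: "valid_problem P"
    and params: "valid_params Q"
    and run: "pfd_sqo_infinite_run P Q Hx Hy x y lam"
    and w: "w = (\<lambda>k. (x k, y k, lam k))"
    and eta: "\<eta> > 0"
    and calH_ge: "\<And>k. calH_u P (par_beta Q) (Hx k) (Hy k) \<succeq>\<^sub>L mat \<eta>"
    and hatH_ge: "\<And>k. hatH_u P (par_beta Q) (Hx k) (Hy k) \<succeq>\<^sub>L mat \<eta>"
    and H_bounded: "\<And>K. infinite K \<Longrightarrow> bounded (w ` K) \<Longrightarrow>
          bounded ((\<lambda>k. calH_u P (par_beta Q) (Hx k) (Hy k)) ` K) \<and>
          bounded ((\<lambda>k. hatH_u P (par_beta Q) (Hx k) (Hy k)) ` K)"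
    and acc_nonempty: "accumulation_points w \<noteq> {}"
    and acc: "(xs, ys, lams) \<in> accumulation_points w"
    and C0: "C0 = aug_lagrangian P (par_beta Q) (x 0) (y 0) (lam 0) - (obj_x P xs + obj_y P ys)"
    and N0: "N0 = min (par_rho Q * \<eta>) (par_xi Q)"
    and eps: "eps = (\<lambda>k. norm (x (Suc k) - x k, y (Suc k) - y k,
                                eq_resid P (x (Suc k)) (y (Suc k))))"
    and epshat: "epshat = (\<lambda>k. eps k / (norm (x k, y k, vec_b P) + 1))"
  shows "(\<forall>k::nat. \<exists>i\<le>k. epshat i \<le> eps i \<and>
              eps i \<le> sqrt (C0 / N0) * sqrt (1 / (real k + 1))) \<and>
         (\<forall>\<epsilon>>0.
            (\<exists>k. eps k < \<epsilon>) \<and>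
            int (iterations_performed (\<lambda>k. eps k < \<epsilon>)) \<le> \<lfloor>C0 / (\<epsilon>\<^sup>2 * N0)\<rfloor> + 1 \<and>
            (\<exists>k. epshat k < \<epsilon>) \<and>
            int (iterations_performed (\<lambda>k. epshat k < \<epsilon>)) \<le> \<lfloor>C0 / (\<epsilon>\<^sup>2 * N0)\<rfloor> + 1)"
proof -
  define L where "L k = aug_lagrangian P (par_beta Q) (x k) (y k) (lam k)" for k
  define Ls where "Ls = aug_lagrangian P (par_beta Q) xs ys lams"
  have "0 < N0"
    using params eta by (simp add: N0 valid_params_def)
  have eps_nonneg: "0 \<le> eps k" for k by (simp add: eps)
  have descent: "N0 * (eps k)\<^sup>2 \<le> L k - L (Suc k)" for k
    using run pfd_sqo_iteration_descent [OF params eta calH_ge hatH_ge]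
    unfolding pfd_sqo_infinite_run_def N0 eps L_def by blast
  then have "decseq L"
    using \<open>0 < N0\<close> by (intro decseq_SucI) (smt (verit) mult_nonneg_nonneg zero_le_power2)
  obtain r where r: "strict_mono r" and "(w \<circ> r) \<longlonglongrightarrow> (xs, ys, lams)"
    using acc by (auto simp: accumulation_points_def)
  then have w_lim: "(\<lambda>m. (x (r m), y (r m), lam (r m))) \<longlonglongrightarrow> (xs, ys, lams)"
    by (simp add: w o_def)
  have lims: "(\<lambda>m. x (r m)) \<longlonglongrightarrow> xs" "(\<lambda>m. y (r m)) \<longlonglongrightarrow> ys" "(\<lambda>m. lam (r m)) \<longlonglongrightarrow> lams"
    using tendsto_fst [OF w_lim] tendsto_fst [OF tendsto_snd [OF w_lim]]
      tendsto_snd [OF tendsto_snd [OF w_lim]] by simp_all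
  have "(L \<circ> r) \<longlonglongrightarrow> Ls"
    using tendsto_aug_lagrangian [OF problem lims] by (simp add: L_def Ls_def o_def)
  note Ls_le = decseq_subseq_LIMSEQ_le [OF \<open>decseq L\<close> r this]
  \<comment> \<open>The bound is first stated with \<open>Ls\<close>: replacing
    \<open>L 0 - Ls\<close> by \<open>C0\<close> relies on feasibility of the limit for the equality
    constraint, which is itself deduced from this bound.\<close>
  have sum_le: "(\<Sum>i<n. (eps i)\<^sup>2) \<le> (L 0 - Ls) / N0" for n
  proof -
    have "N0 * (\<Sum>i<n. (eps i)\<^sup>2) \<le> (\<Sum>i<n. L i - L (Suc i))"
      unfolding sum_distrib_left by (intro sum_mono descent)
    also have "\<dots> \<le> L 0 - Ls"
      \<comment> \<open>The sum telescopes to \<open>L 0 - L n\<close>, and \<open>Ls\<close> is a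
        lower bound for \<open>L n\<close>.\<close>
      using Ls_le [of n] by (simp add: sum_lessThan_telescope')
    finally show ?thesis using \<open>0 < N0\<close> by (simp add: field_simps)
  qed
  have "(\<lambda>k. norm (eq_resid P (x (Suc k)) (y (Suc k)))) \<longlonglongrightarrow> 0"
  proof (rule tendsto_sandwich [OF _ _ tendsto_const sum_sq_le_imp_tendsto_0 [OF sum_le]])
    show "\<forall>\<^sub>F k in sequentially. norm (eq_resid P (x (Suc k)) (y (Suc k))) \<le> eps k"
      unfolding eps by (intro always_eventually allI order_trans [OF norm_snd_le norm_snd_le, THEN order_trans [rotated]]) auto
  qed auto
  \<comment> \<open>\<open>eps k\<close> measures the residual at the new iterate; the limit is
    insensitive to the index shift.\<close>
  then have "(\<lambda>k. eq_resid P (x k) (y k)) \<longlonglongrightarrow> 0"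
    by (simp add: tendsto_norm_zero_iff filterlim_sequentially_Suc [where f = "\<lambda>k. eq_resid P (x k) (y k)"])
  then have "(\<lambda>m. eq_resid P (x (r m)) (y (r m))) \<longlonglongrightarrow> 0"
    using r LIMSEQ_subseq_LIMSEQ by (force simp: o_def)
  then have "eq_resid P xs ys = 0"
    using tendsto_eq_resid [OF lims(1,2)] LIMSEQ_unique by blast
  \<comment> \<open>With zero residual the multiplier and penalty terms of \<open>Ls\<close> vanish
    and only the objective remains.\<close>
  then have "C0 = L 0 - Ls"
    by (simp add: C0 L_def Ls_def aug_lagrangian_def)
  then have S: "(\<Sum>i<n. (eps i)\<^sup>2) \<le> C0 / N0" for n
    using sum_le by simp
  have hat_le: "epshat k \<le> eps k" for k
  proof -
    \<comment> \<open>The scaling denominator is at least 1.\<close>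
    have "eps k / (norm (x k, y k, vec_b P) + 1) \<le> eps k / 1"
      using eps_nonneg by (intro divide_left_mono) (auto simp: add_nonneg_pos)
    then show ?thesis by (simp add: epshat)
  qed
  have rearrange: "C0 / (\<epsilon>\<^sup>2 * N0) = C0 / N0 / \<epsilon>\<^sup>2" for \<epsilon>
    by (simp add: mult.commute)
  have "\<exists>i\<le>k. epshat i \<le> eps i \<and> eps i \<le> sqrt (C0 / N0) * sqrt (1 / (real k + 1))" for k
    using exists_le_sqrt_of_sum_sq_le [OF eps_nonneg S] hat_le by blast
  \<comment> \<open>An arbitrary \<open>stop\<close> treats both tests at once: by
    \<open>hat_le\<close>, \<open>eps k < \<epsilon>\<close> implies
    \<open>epshat k < \<epsilon>\<close>.\<close>
  moreover have "(\<exists>k. stop k) \<and> int (iterations_performed stop) \<le> \<lfloor>C0 / (\<epsilon>\<^sup>2 * N0)\<rfloor> + 1"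
    if "0 < \<epsilon>" and "\<And>k. eps k < \<epsilon> \<Longrightarrow> stop k" for \<epsilon> stop
    unfolding rearrange using iterations_performed_le [OF that(1) S that(2)] by simp
  ultimately show ?thesis
    using le_less_trans [OF hat_le] by simp
qed

end
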